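(* Each reachable belief state of a $\pi$-MOMDP can be written as an element of $\mathcal{S}_v\times B_h^\pi$, where $B_h^\pi$ is the set of possibility distributions over $\mathcal{S}_h$: any $\beta\in B^\pi$ can be written as $(s_v,\beta_h)$ with $\beta_h(s_h)=\max_{\overline{s}_v\in\mathcal{S}_v}\beta(\overline{s}_v,s_h)$ and $s_v=\operatorname{argmax}_{\overline{s}_v\in\mathcal{S}_v}\beta(\overline{s}_v,s_h)$.
   Context: $\mathcal{L}$ is a finite totally ordered set with least element $0_{\mathcal{L}}$ and greatest element $1_{\mathcal{L}}$. A possibility distribution over a finite set $X$ is a function $X\to\mathcal{L}$ whose maximum is $1_{\mathcal{L}}$. A $\pi$-MOMDP (qualitative possibilistic mixed-observable MDP) has a finite state space $\mathcal{S}=\mathcal{S}_v\times\mathcal{S}_h$, where the visible component $s_v$ of a state $s=(s_v,s_h)$ is directly observed by the agent and the hidden component $s_h$ is only partially observed; a finite action set $\mathcal{A}$; transition possibilities $\pi(s'\mid s,a)\in\mathcal{L}$ (a possibility distribution in $s'\in\mathcal{S}$ for each $s\in\mathcal{S}$, $a\in\mathcal{A}$); a set $\mathcal{O}_h$ of observations with possibilities $\pi(o'_h\mid s',a)\in\mathcal{L}$ of observing $o'_h\in\mathcal{O}_h$ when the new state is $s'$ and the action was $a$; and an initial belief $\beta_0$, a possibility distribution over $\mathcal{S}$. The full observation set is $\mathcal{O}=\mathcal{O}_v\times\mathcal{O}_h$ with $\mathcal{O}_v=\mathcal{S}_v$, and for $o'=(o'_v,o'_h)$, $s'=(s'_v,s'_h)$,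 $$\pi(o'\mid s',a)=\begin{cases}\pi(o'_h\mid s',a)&\text{if }o'_v=s'_v,\\ 0_{\mathcal{L}}&\text{otherwise.}\end{cases}$$ The initial visible state $s_{v,0}$ is known by the agent: only states $(s_v,s_h)$ with $s_v=s_{v,0}$ can satisfy $\beta_0(s_v,s_h)>0_{\mathcal{L}}$. $B^\pi$ denotes the possibilistic belief state space, which contains all possibility distributions over $\mathcal{S}$. Belief update: for a belief $\beta$ and an action $a$, $\beta^a(s')=\max_{s\in\mathcal{S}}\min\{\pi(s'\mid s,a),\beta(s)\}$, $\pi(s',o'\mid\beta,a)=\min\{\pi(o'\mid s',a),\beta^a(s')\}$ and $\beta^a(o')=\max_{s'\in\mathcal{S}}\pi(s',o'\mid\beta,a)$. If the agent executes $a$ and then observes $o'$, the new belief is $$\beta^{a,o'}(s')=\begin{cases}1_{\mathcal{L}}&\text{if }\beta^a(o')=\pi(s',o'\mid\beta,a)>0_{\mathcal{L}},\\ \pi(s',o'\mid\beta,a)&\text{otherwise.}\end{cases}$$ The reachable belief states are those that occur as the agent's belief $\beta_t$ at some stage $t\in\mathbb{N}$ of the process, starting from $\beta_0$ and applying this update with the executed actions and received observations.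
   Formalization: "Any β∈B^π" is taken as any reachable β (a β positive on two visible states is no such pair); received observations have β^a(o')>0; s_v is a maximiser for every s_h and the unique one where β_h(s_h)>0, since otherwise all visible states tie. *)

theory Defs
  imports Main
begin

text \<open>
  The finite scale is a type \<open>'l\<close> of sort \<open>{finite, linorder, order_bot, order_top}\<close>; its least
  element is \<open>bot\<close> and its greatest element is \<open>top\<close>. States are pairs (visible, hidden) of type
  \<open>'v \<times> 'h\<close> and observations are pairs of type \<open>'v \<times> 'o\<close>. \<open>trans M s a s'\<close> is the
  possibility of reaching \<open>s'\<close> from \<open>s\<close> under \<open>a\<close>, and \<open>obs_h M s' a oh\<close> the possibility of the
  observation \<open>oh\<close> when \<open>s'\<close> is reached by \<open>a\<close>.
\<close>

record ('v, 'h, 'a, 'o, 'l) momdp =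
  trans :: "'v \<times> 'h \<Rightarrow> 'a \<Rightarrow> 'v \<times> 'h \<Rightarrow> 'l"
  obs_h :: "'v \<times> 'h \<Rightarrow> 'a \<Rightarrow> 'o \<Rightarrow> 'l"
  init_belief :: "'v \<times> 'h \<Rightarrow> 'l"
  init_visible :: "'v"

definition poss_distributions ::
    "('x::finite \<Rightarrow> 'l::{finite, linorder, order_bot, order_top}) set" where
  "poss_distributions = {f. Max (range f) = top}"

definition pi_momdp ::
    "('v::finite, 'h::finite, 'a::finite, 'o, 'l::{finite, linorder, order_bot, order_top}) momdp
      \<Rightarrow> bool" where
  "pi_momdp M \<longleftrightarrow>
    (\<forall>s a. trans M s a \<in> poss_distributions) \<and>
    init_belief M \<in> poss_distributions \<and>
    (\<forall>sv sh. init_belief M (sv, sh) > bot \<longrightarrow> sv = init_visible M)"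

definition obs ::
    "('v, 'h, 'a, 'o, 'l::{finite, linorder, order_bot, order_top}) momdp
      \<Rightarrow> 'v \<times> 'h \<Rightarrow> 'a \<Rightarrow> 'v \<times> 'o \<Rightarrow> 'l" where
  "obs M s' a ob = (if fst ob = fst s' then obs_h M s' a (snd ob) else bot)"

definition predicted ::
    "('v::finite, 'h::finite, 'a, 'o, 'l::{finite, linorder, order_bot, order_top}) momdp
      \<Rightarrow> ('v \<times> 'h \<Rightarrow> 'l) \<Rightarrow> 'a \<Rightarrow> 'v \<times> 'h \<Rightarrow> 'l" where
  "predicted M \<beta> a s' = Max (range (\<lambda>s. min (trans M s a s') (\<beta> s)))"

definition joint ::
    "('v::finite, 'h::finite, 'a, 'o, 'l::{finite, linorder, order_bot, order_top}) momdp
      \<Rightarrow> ('v \<times> 'h \<Rightarrow> 'l) \<Rightarrow> 'a \<Rightarrow> 'v \<times> 'h \<Rightarrow> 'v \<times> 'o \<Rightarrow> 'l" where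
  "joint M \<beta> a s' ob = min (obs M s' a ob) (predicted M \<beta> a s')"

definition obs_poss ::
    "('v::finite, 'h::finite, 'a, 'o, 'l::{finite, linorder, order_bot, order_top}) momdp
      \<Rightarrow> ('v \<times> 'h \<Rightarrow> 'l) \<Rightarrow> 'a \<Rightarrow> 'v \<times> 'o \<Rightarrow> 'l" where
  "obs_poss M \<beta> a ob = Max (range (\<lambda>s'. joint M \<beta> a s' ob))"

definition belief_update ::
    "('v::finite, 'h::finite, 'a, 'o, 'l::{finite, linorder, order_bot, order_top}) momdp
      \<Rightarrow> ('v \<times> 'h \<Rightarrow> 'l) \<Rightarrow> 'a \<Rightarrow> 'v \<times> 'o \<Rightarrow> 'v \<times> 'h \<Rightarrow> 'l" where
  "belief_update M \<beta> a ob s' =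
    (if obs_poss M \<beta> a ob = joint M \<beta> a s' ob \<and> joint M \<beta> a s' ob > bot
     then top else joint M \<beta> a s' ob)"

text \<open>
  Only an observation whose possibility under the current belief is nonzero can be received.
  (For the others the update formula would return the constant function \<open>bot\<close>, which is not a
  possibility distribution unless \<open>bot = top\<close>.)
\<close>

inductive belief_at ::
    "('v::finite, 'h::finite, 'a, 'o, 'l::{finite, linorder, order_bot, order_top}) momdp
      \<Rightarrow> nat \<Rightarrow> ('v \<times> 'h \<Rightarrow> 'l) \<Rightarrow> bool"
  for M where
  init: "belief_at M 0 (init_belief M)"
| step: "belief_at M t \<beta> \<Longrightarrow> obs_poss M \<beta> a ob > bot \<Longrightarrow>
    belief_at M (Suc t) (belief_update M \<beta> a ob)"

definition reachable_beliefs ::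
    "('v::finite, 'h::finite, 'a, 'o, 'l::{finite, linorder, order_bot, order_top}) momdp
      \<Rightarrow> ('v \<times> 'h \<Rightarrow> 'l) set" where
  "reachable_beliefs M = {\<beta>. \<exists>t. belief_at M t \<beta>}"

end

theory Submission imports Defs begin

text \<open>The visible component is part of every observation, and an observation whose visible
  part disagrees with a state has possibility \<open>bot\<close> there. Conditioning on the
  observation therefore wipes out all states outside one visible slice, and the initial belief lives
  on one slice by hypothesis. So each reachable belief is concentrated on some visible value
  \<open>w\<close> (\<open>belief_at_visible\<close>); its restriction to that slice is the hidden
  belief, and since every other slice is constantly \<open>bot\<close>, maximising over the visible
  component just selects \<open>w\<close>.\<close>

lemma poss_distributions_iff:
  fixes f :: "'x::finite \<Rightarrow> 'l::{finite, linorder, order_bot, order_top}"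
  shows "f \<in> poss_distributions \<longleftrightarrow> (\<exists>x. f x = top)"
proof
  assume "f \<in> poss_distributions"
  then have "Max (range f) = top" by (simp add: poss_distributions_def)
  moreover have "Max (range f) \<in> range f" by (intro Max_in) auto
  ultimately obtain x where "f x = top" by (metis rangeE)
  then show "\<exists>x. f x = top" ..
next
  assume "\<exists>x. f x = top"
  then have "top \<in> range f" by (metis rangeI)
  then have "Max (range f) = top" by (intro Max_eqI) auto
  then show "f \<in> poss_distributions" by (simp add: poss_distributions_def)
qed

text \<open>A state maximising the joint possibility exists by finiteness; as that maximum exceeds
  \<open>bot\<close>, the update raises this state to \<open>top\<close>.\<close>

lemma belief_update_poss_distribution:
  assumes "obs_poss M \<beta> a ob > bot"
  shows "belief_update M \<beta> a ob \<in> poss_distributions"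
proof -
  have "obs_poss M \<beta> a ob \<in> range (\<lambda>s'. joint M \<beta> a s' ob)"
    unfolding obs_poss_def by (intro Max_in) auto
  then obtain s' where "obs_poss M \<beta> a ob = joint M \<beta> a s' ob" by auto
  with assms have "belief_update M \<beta> a ob s' = top" by (simp add: belief_update_def)
  then show ?thesis unfolding poss_distributions_iff by blast
qed

lemma belief_update_eq_bot:
  assumes "v \<noteq> fst ob"
  shows "belief_update M \<beta> a ob (v, h) = bot"
  using assms by (simp add: belief_update_def joint_def obs_def min_absorb1)

text \<open>Case analysis suffices instead of induction on \<open>t\<close>: the last update alone
  enforces both properties, whatever the previous belief was. The witness is
  \<open>init_visible M\<close> at the start and \<open>fst ob\<close> after an update.\<close>

lemma belief_at_visible:
  assumes "pi_momdp M" and "belief_at M t \<beta>"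
  shows "\<beta> \<in> poss_distributions \<and> (\<exists>w. \<forall>v h. v \<noteq> w \<longrightarrow> \<beta> (v, h) = bot)"
  using assms(2)
proof cases
  case init
  then have "\<beta> (v, h) = bot" if "v \<noteq> init_visible M" for v h
    using assms(1) that unfolding pi_momdp_def bot.not_eq_extremum[symmetric] by blast
  with init assms(1) show ?thesis unfolding pi_momdp_def by blast
next
  case (step t' \<beta>' a ob)
  then show ?thesis
    using belief_update_poss_distribution[of M \<beta>' a ob]
      belief_update_eq_bot[of _ ob M \<beta>' a] by blast
qed

theorem theorem1:
  fixes M :: "('v::finite, 'h::finite, 'a::finite, 'o,
                'l::{finite, linorder, order_bot, order_top}) momdp"
    and \<beta> :: "'v \<times> 'h \<Rightarrow> 'l"
  assumes "pi_momdp M"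
    and "\<beta> \<in> reachable_beliefs M"
  shows "\<exists>s\<^sub>v \<beta>\<^sub>h. \<beta>\<^sub>h \<in> poss_distributions \<and>
    (\<forall>v s\<^sub>h. \<beta> (v, s\<^sub>h) = (if v = s\<^sub>v then \<beta>\<^sub>h s\<^sub>h else bot)) \<and>
    (\<forall>s\<^sub>h. \<beta>\<^sub>h s\<^sub>h = Max (range (\<lambda>v. \<beta> (v, s\<^sub>h)))) \<and>
    (\<forall>s\<^sub>h. is_arg_max (\<lambda>v. \<beta> (v, s\<^sub>h)) (\<lambda>v. True) s\<^sub>v) \<and>
    (\<forall>s\<^sub>h. \<beta>\<^sub>h s\<^sub>h > bot \<longrightarrow>
      (\<forall>v. is_arg_max (\<lambda>v. \<beta> (v, s\<^sub>h)) (\<lambda>v. True) v \<longrightarrow> v = s\<^sub>v))"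
proof -
  obtain w where poss: "\<beta> \<in> poss_distributions"
    and off: "\<And>v h. v \<noteq> w \<Longrightarrow> \<beta> (v, h) = bot"
    using assms belief_at_visible unfolding reachable_beliefs_def by blast
  \<comment> \<open>Slice \<open>w\<close> dominates pointwise, which yields the normalisation, the
    maximum formula and the arg max property below.\<close>
  have le: "\<beta> (v, h) \<le> \<beta> (w, h)" for v h
    using off[of v h] by (cases "v = w") auto
  obtain v h where top: "\<beta> (v, h) = top"
    using poss by (auto simp: poss_distributions_iff)
  \<comment> \<open>The value \<open>top\<close> is attained somewhere, hence by domination also on
    slice \<open>w\<close> at the same hidden state.\<close>
  have "\<beta> (w, h) = top"
    using le[of v h] top by (simp add: top_unique)
  then have "(\<lambda>h. \<beta> (w, h)) \<in> poss_distributions"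
    by (auto simp: poss_distributions_iff)
  moreover have "\<beta> (w, h) = Max (range (\<lambda>v. \<beta> (v, h)))" for h
    using le by (intro Max_eqI[symmetric]) auto
  moreover have "is_arg_max (\<lambda>v. \<beta> (v, h)) (\<lambda>v. True) w" for h
    using le by (simp add: is_arg_max_linorder)
  \<comment> \<open>Where \<beta> is \<open>bot\<close> on slice \<open>w\<close>, all visible
    values tie; strict positivity makes \<open>w\<close> the only maximiser.\<close>
  moreover have "v = w"
    if "\<beta> (w, h) > bot" "is_arg_max (\<lambda>v. \<beta> (v, h)) (\<lambda>v. True) v" for v h
  proof (rule ccontr)
    assume "v \<noteq> w"
    then have "\<beta> (v, h) < \<beta> (w, h)" using off that(1) by simp
    then show False using that(2) by (simp add: is_arg_max_def)
  qed
  moreover have "\<beta> (v, h) = (if v = w then \<beta> (w, h) else bot)" for v h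
    using off by simp
  ultimately show ?thesis
    by (intro exI[of _ w] exI[of _ "\<lambda>h. \<beta> (w, h)"] conjI allI impI)
qed

end
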